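(* $\tilde{\mathbb X}\equiv\mathbb X\subseteq\mathbb X_{nc}$, where $A\equiv B$ means that there is a bijection between the sets $A$ and $B$.
   Context: Let $N^+=\{0,\dots,n\}$, $N=\{1,\dots,n\}$ and let $\tilde G=(N^+,\tilde E)$ be a connected directed graph with $m=|\tilde E|$ edges, obtained by arbitrarily orienting a connected undirected simple graph. Each line $j\to k\in\tilde E$ has nonzero complex impedance $z_{jk}$ and admittance $y_{jk}=1/z_{jk}$. For complex numbers, $a\le b$ means inequality of both real and imaginary parts. Given are bounds $\underline v_j\le\overline v_j$ with $\underline v_j>0$ and complex bounds $\underline s_j,\overline s_j$ (possibly infinite), $j\in N^+$; for the slack bus $V_0=1$, $\underline v_0=\overline v_0=1$, and the bounds on $s_0$ are infinite (no constraint). $\tilde{\mathbb X}$ (the feasible set of optimal power flow in the branch flow model) is the set of $\tilde x=(S,I,V,s)\in\mathbb C^{2(m+n+1)}$ with $V_0=1$ such that - $\sum_{k:j\to k}S_{jk}=\sum_{i:i\to j}(S_{ij}-z_{ij}|I_{ij}|^2)+s_j$, $j\in N^+$; - $I_{jk}=y_{jk}(V_j-V_k)$ and $S_{jk}=V_jI_{jk}^H$, $j\to k\in\tilde E$; - $\underline v_j\le|V_j|^2\le\overline v_j$ and $\underline s_j\le s_j\le\overline s_j$, $j\in N^+$. $\mathbb X_{nc}$ is the set of $x=(S,\ell,v,s)\in\mathbb R^{3(m+n+1)}$ ($S\in\mathbb C^m$ and $s\in\mathbb C^{n+1}$ regarded as real vectors, $\ell\in\mathbb R^m$, $v\in\mathbb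 R^{n+1}$) such that - $\sum_{k:j\to k}S_{jk}=\sum_{i:i\to j}(S_{ij}-z_{ij}\ell_{ij})+s_j$, $j\in N^+$; - $v_j-v_k=2\operatorname{Re}(z_{jk}^HS_{jk})-|z_{jk}|^2\ell_{jk}$ and $v_j\ell_{jk}=|S_{jk}|^2$, $j\to k\in\tilde E$; - $\underline v_j\le v_j\le\overline v_j$ and $\underline s_j\le s_j\le\overline s_j$, $j\in N^+$. For $x=(S,\ell,v,s)$ define $\beta(x)\in\mathbb R^m$ by $\beta_{jk}(x)=\angle(v_j-z_{jk}^HS_{jk})$ for $j\to k\in\tilde E$. Let $B$ be the $m\times n$ reduced incidence matrix: for $l\in\tilde E$, $j\in N$, $B_{lj}=1$ if $l$ leaves $j$, $-1$ if $l$ enters $j$, $0$ otherwise. $\mathbb X$ is the set of $x\in\mathbb X_{nc}$ for which there exists $\theta\in\mathbb R^n$ with $B\theta=\beta(x)\mod 2\pi$ (componentwise). *)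

theory Defs
  imports
    "HOL-Analysis.Analysis"
    "HOL-Library.Real_Mod"
    "Graph_Theory.Graph_Theory"
begin

(* "pair_graph" models an undirected simple graph as a symmetric loop-free relation;
   an orientation keeps exactly one of the two arcs of every undirected edge. *)
definition orientation_of :: "'a pair_pre_digraph \<Rightarrow> 'a pair_pre_digraph \<Rightarrow> bool" where
  "orientation_of D U \<longleftrightarrow>
     pverts D = pverts U \<and> parcs D \<subseteq> parcs U \<and>
     (\<forall>(j, k) \<in> parcs U. (j, k) \<in> parcs D \<longleftrightarrow> (k, j) \<notin> parcs D)"

(* The injection bounds are extended complex numbers, given as pairs
   (real part, imaginary part); infinite entries impose no constraint. *)
record opf =
  num_buses :: nat
  grid :: "nat pair_pre_digraph"
  impedance :: "nat \<times> nat \<Rightarrow> complex"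
  v_min :: "nat \<Rightarrow> real"
  v_max :: "nat \<Rightarrow> real"
  s_min :: "nat \<Rightarrow> ereal \<times> ereal"
  s_max :: "nat \<Rightarrow> ereal \<times> ereal"

(* Bus 0 is the slack bus, so there are num_buses P + 1 buses. *)
definition buses :: "opf \<Rightarrow> nat set" where
  "buses P = {0..num_buses P}"

definition lines :: "opf \<Rightarrow> (nat \<times> nat) set" where
  "lines P = parcs (grid P)"

definition admittance :: "opf \<Rightarrow> nat \<times> nat \<Rightarrow> complex" where
  "admittance P e = 1 / impedance P e"

definition ext_complex :: "complex \<Rightarrow> ereal \<times> ereal" where
  "ext_complex c = (ereal (Re c), ereal (Im c))"

(* The order on pairs is the componentwise one, i.e. the order of both real and
   imaginary parts. *)
definition injection_bounds :: "opf \<Rightarrow> (nat \<Rightarrow> complex) \<Rightarrow> bool" where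
  "injection_bounds P s \<longleftrightarrow>
     (\<forall>j \<in> buses P. s_min P j \<le> ext_complex (s j) \<and> ext_complex (s j) \<le> s_max P j)"

(* The argument l stands for the squared current magnitudes. *)
definition power_balance ::
    "opf \<Rightarrow> (nat \<times> nat \<Rightarrow> complex) \<Rightarrow> (nat \<times> nat \<Rightarrow> real) \<Rightarrow> (nat \<Rightarrow> complex) \<Rightarrow> bool" where
  "power_balance P S l s \<longleftrightarrow>
     (\<forall>j \<in> buses P.
        (\<Sum>k \<in> {k. (j, k) \<in> lines P}. S (j, k)) =
        (\<Sum>i \<in> {i. (i, j) \<in> lines P}.
           S (i, j) - impedance P (i, j) * complex_of_real (l (i, j))) + s j)"

(* Vectors indexed by lines or buses are extensional functions on those index sets,
   so that distinct tuples are distinct points. *)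
definition X_bfm ::
    "opf \<Rightarrow> ((nat \<times> nat \<Rightarrow> complex) \<times> (nat \<times> nat \<Rightarrow> complex) \<times>
             (nat \<Rightarrow> complex) \<times> (nat \<Rightarrow> complex)) set" where
  "X_bfm P = {(S, I, V, s).
     S \<in> extensional (lines P) \<and> I \<in> extensional (lines P) \<and>
     V \<in> extensional (buses P) \<and> s \<in> extensional (buses P) \<and>
     V 0 = 1 \<and>
     power_balance P S (\<lambda>e. (cmod (I e))\<^sup>2) s \<and>
     (\<forall>(j, k) \<in> lines P.
        I (j, k) = admittance P (j, k) * (V j - V k) \<and>
        S (j, k) = V j * cnj (I (j, k))) \<and>
     (\<forall>j \<in> buses P. v_min P j \<le> (cmod (V j))\<^sup>2 \<and> (cmod (V j))\<^sup>2 \<le> v_max P j) \<and>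
     injection_bounds P s}"

type_synonym relaxed_point =
  "(nat \<times> nat \<Rightarrow> complex) \<times> (nat \<times> nat \<Rightarrow> real) \<times> (nat \<Rightarrow> real) \<times> (nat \<Rightarrow> complex)"

definition X_nc :: "opf \<Rightarrow> relaxed_point set" where
  "X_nc P = {(S, l, v, s).
     S \<in> extensional (lines P) \<and> l \<in> extensional (lines P) \<and>
     v \<in> extensional (buses P) \<and> s \<in> extensional (buses P) \<and>
     power_balance P S l s \<and>
     (\<forall>(j, k) \<in> lines P.
        v j - v k = 2 * Re (cnj (impedance P (j, k)) * S (j, k))
                    - (cmod (impedance P (j, k)))\<^sup>2 * l (j, k) \<and>
        v j * l (j, k) = (cmod (S (j, k)))\<^sup>2) \<and>
     (\<forall>j \<in> buses P. v_min P j \<le> v j \<and> v j \<le> v_max P j) \<and>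
     injection_bounds P s}"

definition angle_diff :: "opf \<Rightarrow> relaxed_point \<Rightarrow> nat \<times> nat \<Rightarrow> real" where
  "angle_diff P = (\<lambda>(S, l, v, s) (j, k).
     Arg (complex_of_real (v j) - cnj (impedance P (j, k)) * S (j, k)))"

definition incidence :: "nat \<times> nat \<Rightarrow> nat \<Rightarrow> real" where
  "incidence e j = (if fst e = j then 1 else if snd e = j then - 1 else 0)"

(* The slack bus is dropped: the incidence matrix is reduced to the columns 1..n. *)
definition X_angle :: "opf \<Rightarrow> relaxed_point set" where
  "X_angle P = {x \<in> X_nc P. \<exists>\<theta> \<in> extensional {1..num_buses P}.
     \<forall>e \<in> lines P.
       [(\<Sum>j = 1..num_buses P. incidence e j * \<theta> j) = angle_diff P x e] (rmod (2 * pi))}"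

end

theory Submission
  imports Defs
begin

text \<open>The bijection forgets the phases, sending $(S, I, V, s)$ to $(S, |I|^2, |V|^2, s)$. Ohm's law
  and the definition of the power flow together say that $|V_j|^2 - \overline{z_{jk}} S_{jk}
  = V_j \overline{V_k}$, so $\beta_{jk}$ is the phase difference across the line $j \to k$ and the
  bus phases are the required $\theta$. Conversely, these products and the reference $V_0 = 1$
  determine $V$ because the graph is connected, and in $\mathbb{X}_{nc}$ one has
  $|v_j - \overline{z_{jk}} S_{jk}|^2 = v_j v_k$, so that $V_j = \sqrt{v_j}\, e^{i \theta_j}$
  satisfies the product equation as soon as $\theta$ matches $\beta$.\<close>

text \<open>Connectedness is reachability in the symmetric closure, so the equality propagates by
  induction along a path that may use arcs against their direction.\<close>

lemma connected_eqI:
  assumes "Digraph_Component.connected (with_proj U)"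
    and "u \<in> pverts U" "v \<in> pverts U"
    and step: "\<And>j k. (j, k) \<in> parcs U \<Longrightarrow> f j = f k"
  shows "f u = f v"
proof -
  have "(u, v) \<in> (parcs (mk_symmetric (with_proj U)))\<^sup>*"
    using assms(1-3) reachable_rtranclI[of "with_proj (mk_symmetric (with_proj U))" u v]
    unfolding Digraph_Component.connected_def strongly_connected_def by simp
  then show ?thesis
  proof induction
    case (step y z)
    then have "(y, z) \<in> parcs U \<or> (z, y) \<in> parcs U"
      by (auto simp: parcs_mk_symmetric)
    then show ?case
      using step.IH assms(4) by metis
  qed simp
qed

text \<open>Multiplication by the nonzero \<open>cnj z\<close> clears the admittance. The
  equivalence serves both ways: to read phases off a feasible point and to recover the power flow
  from constructed voltages.\<close>

lemma power_flow_iff_voltage_product: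
  fixes z :: complex
  assumes "z \<noteq> 0"
  shows "S = Vj * cnj (1 / z * (Vj - Vk)) \<longleftrightarrow>
    complex_of_real ((cmod Vj)\<^sup>2) - cnj z * S = Vj * cnj Vk"
proof -
  have "S = Vj * cnj (1 / z * (Vj - Vk)) \<longleftrightarrow> cnj z * S = Vj * cnj (Vj - Vk)"
    using assms by (auto simp: field_simps)
  also have "\<dots> \<longleftrightarrow> Vj * cnj Vj - cnj z * S = Vj * cnj Vk"
    by (auto simp: algebra_simps)
  finally show ?thesis
    unfolding complex_norm_square .
qed

lemma cmod_of_real_minus_sq:
  "(cmod (complex_of_real a - w))\<^sup>2 = a\<^sup>2 - 2 * a * Re w + (cmod w)\<^sup>2"
  unfolding cmod_power2 by (simp add: power2_eq_square algebra_simps)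

lemma branch_equations:
  fixes z :: complex
  assumes "z \<noteq> 0"
    and I: "I = 1 / z * (Vj - Vk)"
    and S: "S = Vj * cnj I"
  shows "(cmod Vj)\<^sup>2 - (cmod Vk)\<^sup>2 = 2 * Re (cnj z * S) - (cmod z)\<^sup>2 * (cmod I)\<^sup>2"
    and "(cmod Vj)\<^sup>2 * (cmod I)\<^sup>2 = (cmod S)\<^sup>2"
proof -
  have Vk: "Vk = Vj - z * I"
    using assms(1) I by simp
  show "(cmod Vj)\<^sup>2 - (cmod Vk)\<^sup>2 = 2 * Re (cnj z * S) - (cmod z)\<^sup>2 * (cmod I)\<^sup>2"
    unfolding S Vk cmod_power2 by (simp add: power2_eq_square algebra_simps)
  show "(cmod Vj)\<^sup>2 * (cmod I)\<^sup>2 = (cmod S)\<^sup>2"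
    unfolding S by (simp add: norm_mult power_mult_distrib)
qed

text \<open>Once \<open>vj * l\<close> replaces the squared modulus of \<open>S\<close>, the
  expanded square has the factor \<open>vj\<close>, and the voltage drop equation identifies the
  other factor with \<open>vk\<close>.\<close>

lemma cmod_voltage_product:
  assumes "0 < vj" "0 < vk"
    and "vj - vk = 2 * Re (cnj z * S) - (cmod z)\<^sup>2 * l"
    and "vj * l = (cmod S)\<^sup>2"
  shows "cmod (complex_of_real vj - cnj z * S) = sqrt vj * sqrt vk"
proof -
  have "(cmod (complex_of_real vj - cnj z * S))\<^sup>2
      = vj\<^sup>2 - 2 * vj * Re (cnj z * S) + (cmod z)\<^sup>2 * (vj * l)"
    unfolding cmod_of_real_minus_sq assms(4) by (simp add: norm_mult power_mult_distrib)
  also have "\<dots> = vj * (vj - (2 * Re (cnj z * S) - (cmod z)\<^sup>2 * l))"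
    by (simp add: power2_eq_square algebra_simps)
  also have "\<dots> = (sqrt vj * sqrt vk)\<^sup>2"
    unfolding assms(3)[symmetric] using assms(1,2) by (simp add: power_mult_distrib)
  finally show ?thesis
    using assms(1,2) by simp
qed

text \<open>The update \<open>\<theta>(0 := 0)\<close> restores the column of the slack bus with
  phase zero, so lines at bus 0 need no separate case.\<close>

lemma incidence_sum:
  assumes "j \<le> n" "k \<le> n" "j \<noteq> k"
  shows "(\<Sum>i = 1..n. incidence (j, k) i * \<theta> i) = (\<theta>(0 := 0)) j - (\<theta>(0 := 0)) k"
proof -
  have "(\<Sum>i = 1..n. incidence (j, k) i * \<theta> i) = (\<Sum>i = 0..n. incidence (j, k) i * (\<theta>(0 := 0)) i)"
    by (intro sum.mono_neutral_cong_left) auto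
  also have "\<dots> = (\<Sum>i = 0..n. (if j = i then (\<theta>(0 := 0)) i else 0) -
      (if k = i then (\<theta>(0 := 0)) i else 0))"
    using assms(3) by (intro sum.cong) (auto simp: incidence_def)
  also have "\<dots> = (\<theta>(0 := 0)) j - (\<theta>(0 := 0)) k"
    using assms(1,2) by (simp add: sum_subtractf)
  finally show ?thesis .
qed

text \<open>Congruence modulo \<open>2 * pi\<close> is equality under \<open>cis\<close>, and the
  nonzero modulus cancels. The angle condition thus becomes a polar form.\<close>

lemma rcong_Arg_iff:
  assumes "w \<noteq> 0"
  shows "[a = Arg w] (rmod (2 * pi)) \<longleftrightarrow> w = complex_of_real (cmod w) * cis a"
proof -
  have "[a = Arg w] (rmod (2 * pi)) \<longleftrightarrow> cis a = cis (Arg w)"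
    by (simp add: cis_eq_iff)
  also have "\<dots> \<longleftrightarrow> complex_of_real (cmod w) * cis a = w"
    using assms rcis_cmod_Arg[of w] by (auto simp: rcis_def) (metis mult_cancel_left norm_eq_zero of_real_eq_0_iff)
  finally show ?thesis by auto
qed

definition forget_phases :: "opf \<Rightarrow> (nat \<times> nat \<Rightarrow> complex) \<times> (nat \<times> nat \<Rightarrow> complex) \<times>
    (nat \<Rightarrow> complex) \<times> (nat \<Rightarrow> complex) \<Rightarrow> relaxed_point" where
  "forget_phases P = (\<lambda>(S, I, V, s).
     (S, \<lambda>e\<in>lines P. (cmod (I e))\<^sup>2, \<lambda>j\<in>buses P. (cmod (V j))\<^sup>2, s))"

lemma power_balance_cong:
  assumes "\<And>e. e \<in> lines P \<Longrightarrow> l e = l' e"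
  shows "power_balance P S l s \<longleftrightarrow> power_balance P S l' s"
proof -
  have "(\<Sum>i \<in> {i. (i, j) \<in> lines P}. S (i, j) - impedance P (i, j) * complex_of_real (l (i, j)))
      = (\<Sum>i \<in> {i. (i, j) \<in> lines P}. S (i, j) - impedance P (i, j) * complex_of_real (l' (i, j)))"
    for j
    using assms by (intro sum.cong) auto
  then show ?thesis
    unfolding power_balance_def by simp
qed

text \<open>Connectivity enters only as \<open>bus_eqI\<close>. It is stated for complex-valued
  functions because it is applied to ratios of voltages.\<close>

locale opf_network =
  fixes P :: opf
  assumes line_buses: "(j, k) \<in> lines P \<Longrightarrow> j \<in> buses P \<and> k \<in> buses P \<and> j \<noteq> k"
    and impedance_nonzero: "e \<in> lines P \<Longrightarrow> impedance P e \<noteq> 0"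
    and v_min_pos: "j \<in> buses P \<Longrightarrow> 0 < v_min P j"
    and slack_bounds: "v_min P 0 = 1" "v_max P 0 = 1"
    and bus_eqI: "\<lbrakk>j \<in> buses P; k \<in> buses P; \<And>j k. (j, k) \<in> lines P \<Longrightarrow> f j = f k\<rbrakk> \<Longrightarrow>
      f j = (f k :: complex)"
begin

lemma slack_bus [simp]: "0 \<in> buses P"
  by (simp add: buses_def)

lemma incidence_sum_line:
  assumes "(j, k) \<in> lines P"
  shows "(\<Sum>i = 1..num_buses P. incidence (j, k) i * \<theta> i) = (\<theta>(0 := 0)) j - (\<theta>(0 := 0)) k"
  using incidence_sum line_buses[OF assms] by (simp add: buses_def)

lemma voltage_nonzero:
  assumes "(S, I, V, s) \<in> X_bfm P" "j \<in> buses P"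
  shows "V j \<noteq> 0"
proof -
  have "v_min P j \<le> (cmod (V j))\<^sup>2"
    using assms by (simp add: X_bfm_def)
  then show ?thesis
    using v_min_pos[OF assms(2)] by auto
qed

lemma voltage_product:
  assumes "(S, I, V, s) \<in> X_bfm P" and jk: "(j, k) \<in> lines P"
  shows "complex_of_real ((cmod (V j))\<^sup>2) - cnj (impedance P (j, k)) * S (j, k) = V j * cnj (V k)"
proof -
  have "S (j, k) = V j * cnj (1 / impedance P (j, k) * (V j - V k))"
    using assms by (auto simp: X_bfm_def admittance_def)
  then show ?thesis
    using power_flow_iff_voltage_product[OF impedance_nonzero[OF jk]] by blast
qed

lemma forget_phases_in_X_nc:
  assumes "(S, I, V, s) \<in> X_bfm P"
  shows "forget_phases P (S, I, V, s) \<in> X_nc P"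
proof -
  have "(cmod (V j))\<^sup>2 - (cmod (V k))\<^sup>2 = 2 * Re (cnj (impedance P (j, k)) * S (j, k))
        - (cmod (impedance P (j, k)))\<^sup>2 * (cmod (I (j, k)))\<^sup>2 \<and>
      (cmod (V j))\<^sup>2 * (cmod (I (j, k)))\<^sup>2 = (cmod (S (j, k)))\<^sup>2"
    if "(j, k) \<in> lines P" for j k
  proof -
    have "I (j, k) = 1 / impedance P (j, k) * (V j - V k)" "S (j, k) = V j * cnj (I (j, k))"
      using assms that by (auto simp: X_bfm_def admittance_def)
    from branch_equations[OF impedance_nonzero[OF that] this] show ?thesis
      by blast
  qed
  moreover have "power_balance P S (\<lambda>e\<in>lines P. (cmod (I e))\<^sup>2) s"
    using assms power_balance_cong[of P "\<lambda>e\<in>lines P. (cmod (I e))\<^sup>2" "\<lambda>e. (cmod (I e))\<^sup>2"]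
    by (simp add: X_bfm_def)
  ultimately show ?thesis
    using assms line_buses by (auto simp: X_bfm_def X_nc_def forget_phases_def)
qed

lemma forget_phases_in_X_angle:
  assumes x: "(S, I, V, s) \<in> X_bfm P"
  shows "forget_phases P (S, I, V, s) \<in> X_angle P"
proof -
  define \<theta> where "\<theta> = (\<lambda>j\<in>{1..num_buses P}. Arg (V j))"
  have "V 0 = 1"
    using x by (simp add: X_bfm_def)
  \<comment> \<open>At the slack bus the inserted phase 0 is correct, since
    \<open>Arg 1 = 0\<close>.\<close>
  then have \<theta>: "(\<theta>(0 := 0)) j = Arg (V j)" if "j \<in> buses P" for j
    using that by (auto simp: \<theta>_def buses_def)
  have "[(\<Sum>i = 1..num_buses P. incidence (j, k) i * \<theta> i) =
      angle_diff P (forget_phases P (S, I, V, s)) (j, k)] (rmod (2 * pi))"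
    if jk: "(j, k) \<in> lines P" for j k
  proof -
    have b: "j \<in> buses P" "k \<in> buses P"
      using line_buses[OF jk] by auto
    have nz: "V j * cnj (V k) \<noteq> 0"
      using voltage_nonzero[OF x] b by simp
    \<comment> \<open>The difference of the two arguments may leave the principal range, so it
      matches the argument of the product only modulo \<open>2 * pi\<close>.\<close>
    have "V j * cnj (V k) = rcis (cmod (V j)) (Arg (V j)) * cnj (rcis (cmod (V k)) (Arg (V k)))"
      by (simp add: rcis_cmod_Arg)
    also have "\<dots> = complex_of_real (cmod (V j * cnj (V k))) * (cis (Arg (V j)) * cis (- Arg (V k)))"
      by (simp add: rcis_def cis_cnj norm_mult)
    finally have "[Arg (V j) - Arg (V k) = Arg (V j * cnj (V k))] (rmod (2 * pi))"
      unfolding rcong_Arg_iff[OF nz] cis_mult by simp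
    then show ?thesis
      using voltage_product[OF x jk] b
      unfolding incidence_sum_line[OF jk] by (simp add: \<theta> angle_diff_def forget_phases_def del: fun_upd_apply)
  qed
  moreover have "\<theta> \<in> extensional {1..num_buses P}"
    by (simp add: \<theta>_def)
  ultimately show ?thesis
    using forget_phases_in_X_nc[OF x] unfolding X_angle_def
    by (intro CollectI conjI bexI[of _ \<theta>] ballI) auto
qed

text \<open>Two preimages share magnitudes and voltage products, so the ratio of their voltages is
  constant along lines. By connectivity it equals its value 1 at the slack bus, and Ohm's law then
  fixes the currents.\<close>

lemma inj_on_forget_phases: "inj_on (forget_phases P) (X_bfm P)"
proof (rule inj_onI, unfold split_paired_all)
  fix S I V s S' I' V' s'
  assume x: "(S, I, V, s) \<in> X_bfm P" and x': "(S', I', V', s') \<in> X_bfm P"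
    and eq: "forget_phases P (S, I, V, s) = forget_phases P (S', I', V', s')"
  have [simp]: "S' = S" "s' = s"
    using eq by (simp_all add: forget_phases_def)
  have norm_eq: "(cmod (V j))\<^sup>2 = (cmod (V' j))\<^sup>2" if "j \<in> buses P" for j
    using eq that by (auto simp: forget_phases_def dest: fun_cong[where x = j])
  have ratio: "V' j / V j = V' k / V k" if jk: "(j, k) \<in> lines P" for j k
  proof -
    have b: "j \<in> buses P" "k \<in> buses P"
      using line_buses[OF jk] by auto
    have prod_eq: "V j * cnj (V k) = V' j * cnj (V' k)"
      using voltage_product[OF x jk] voltage_product[OF x' jk] norm_eq[OF b(1)] by simp
    have "V k * cnj (V k) = V' k * cnj (V' k)"
      using norm_eq[OF b(2)] by (metis complex_norm_square of_real_eq_iff)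
    \<comment> \<open>The nonzero common factor produces \<open>V' j * cnj (V' k)\<close> on the
      left and \<open>V j * cnj (V k)\<close> on the right, each times a squared magnitude at
      \<open>k\<close>.\<close>
    then have "(V' j * V k) * (cnj (V k) * cnj (V' k)) = (V' k * V j) * (cnj (V k) * cnj (V' k))"
      using prod_eq by algebra
    then have "V' j * V k = V' k * V j"
      using voltage_nonzero[OF x b(2)] voltage_nonzero[OF x' b(2)] by simp
    then show ?thesis
      using voltage_nonzero[OF x] b by (simp add: frac_eq_eq)
  qed
  have "V' j = V j" if j: "j \<in> buses P" for j
  proof -
    have "V' j / V j = V' 0 / V 0"
      by (rule bus_eqI[OF j slack_bus]) (fact ratio)
    also have "\<dots> = 1"
      using x x' by (simp add: X_bfm_def)
    finally show ?thesis
      using voltage_nonzero[OF x j] by simp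
  qed
  then have V: "V' = V"
    using x x' by (intro extensionalityI[of _ "buses P"]) (auto simp: X_bfm_def)
  have "I' (j, k) = I (j, k)" if "(j, k) \<in> lines P" for j k
    using x x' that by (auto simp: X_bfm_def V dest!: bspec)
  then have "I' = I"
    using x x' by (intro extensionalityI[of _ "lines P"]) (auto simp: X_bfm_def)
  with V show "(S, I, V, s) = (S', I', V', s')"
    by simp
qed

text \<open>The preimage takes its voltages from \<open>v\<close> and the given phases and its
  currents from Ohm's law. It remains to recover \<open>S\<close> and \<open>l\<close> from
  them.\<close>

lemma X_angle_subset_image: "X_angle P \<subseteq> forget_phases P ` X_bfm P"
proof (clarify)
  fix S l v s
  assume x: "(S, l, v, s) \<in> X_angle P"
  then have nc: "(S, l, v, s) \<in> X_nc P"
    by (simp add: X_angle_def)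
  obtain \<theta> where \<theta>: "\<And>j k. (j, k) \<in> lines P \<Longrightarrow>
      [(\<Sum>i = 1..num_buses P. incidence (j, k) i * \<theta> i) =
        Arg (complex_of_real (v j) - cnj (impedance P (j, k)) * S (j, k))] (rmod (2 * pi))"
    using x by (fastforce simp: X_angle_def angle_diff_def)
  \<comment> \<open>The value of \<open>\<theta>\<close> at 0 is arbitrary; resetting it to 0 makes
    \<open>V 0\<close> real and positive.\<close>
  define \<phi> where "\<phi> = \<theta>(0 := 0)"
  define V where "V = (\<lambda>j\<in>buses P. rcis (sqrt (v j)) (\<phi> j))"
  define I where "I = (\<lambda>(j, k)\<in>lines P. admittance P (j, k) * (V j - V k))"
  have v_pos: "0 < v j" if "j \<in> buses P" for j
    using nc that by (auto simp: X_nc_def intro: less_le_trans[OF v_min_pos])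
  \<comment> \<open>The coinciding slack bounds pin \<open>v 0\<close>, which gives
    \<open>V 0 = 1\<close> below.\<close>
  have "v_min P 0 \<le> v 0 \<and> v 0 \<le> v_max P 0"
    using nc by (simp add: X_nc_def)
  then have v0: "v 0 = 1"
    by (simp add: slack_bounds)
  have V_sq: "(cmod (V j))\<^sup>2 = v j" if "j \<in> buses P" for j
    using v_pos[OF that] that by (simp add: V_def)
  have S_eq: "S (j, k) = V j * cnj (I (j, k))" if jk: "(j, k) \<in> lines P" for j k
  proof -
    have b: "j \<in> buses P" "k \<in> buses P"
      using line_buses[OF jk] by auto
    define w where "w = complex_of_real (v j) - cnj (impedance P (j, k)) * S (j, k)"
    have w_norm: "cmod w = sqrt (v j) * sqrt (v k)"
      unfolding w_def using nc jk v_pos b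
      by (intro cmod_voltage_product[where l = "l (j, k)"]) (auto simp: X_nc_def)
    then have "w \<noteq> 0"
      using v_pos[OF b(1)] v_pos[OF b(2)] by auto
    then have "w = complex_of_real (cmod w) * cis (\<phi> j - \<phi> k)"
      using \<theta>[OF jk] unfolding incidence_sum_line[OF jk] \<phi>_def w_def
      by (subst (asm) rcong_Arg_iff)
    also have "\<dots> = V j * cnj (V k)"
      unfolding w_norm using b
      by (simp add: V_def rcis_def cis_cnj cis_mult[of "\<phi> j" "- \<phi> k", simplified, symmetric])
    finally have "complex_of_real ((cmod (V j))\<^sup>2) - cnj (impedance P (j, k)) * S (j, k) = V j * cnj (V k)"
      unfolding w_def V_sq[OF b(1)] .
    then have "S (j, k) = V j * cnj (1 / impedance P (j, k) * (V j - V k))"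
      using power_flow_iff_voltage_product[OF impedance_nonzero[OF jk]] by blast
    then show ?thesis
      using jk by (simp add: I_def admittance_def)
  qed
  have I_sq: "(cmod (I (j, k)))\<^sup>2 = l (j, k)" if jk: "(j, k) \<in> lines P" for j k
  proof -
    have b: "j \<in> buses P"
      using line_buses[OF jk] by auto
    \<comment> \<open>Both \<open>l\<close> and the squared current give the squared power when
      multiplied by \<open>v j\<close>, which is positive and cancels.\<close>
    have "v j * l (j, k) = (cmod (S (j, k)))\<^sup>2"
      using nc jk by (auto simp: X_nc_def)
    also have "\<dots> = v j * (cmod (I (j, k)))\<^sup>2"
      unfolding S_eq[OF jk] by (simp add: norm_mult power_mult_distrib V_sq[OF b])
    finally show ?thesis
      using v_pos[OF b] by simp
  qed
  have "power_balance P S (\<lambda>e. (cmod (I e))\<^sup>2) s"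
    using nc power_balance_cong[of P "\<lambda>e. (cmod (I e))\<^sup>2" l] I_sq by (auto simp: X_nc_def)
  moreover have "V 0 = 1"
    by (simp add: V_def v0 \<phi>_def)
  moreover have "I (j, k) = admittance P (j, k) * (V j - V k)" if "(j, k) \<in> lines P" for j k
    using that by (simp add: I_def)
  ultimately have mem: "(S, I, V, s) \<in> X_bfm P"
    using nc S_eq by (auto simp: X_bfm_def X_nc_def V_sq) (simp_all add: I_def V_def)
  have "(\<lambda>e\<in>lines P. (cmod (I e))\<^sup>2) = l" "(\<lambda>j\<in>buses P. (cmod (V j))\<^sup>2) = v"
    using nc I_sq V_sq
    by (auto intro!: extensionalityI[of _ "lines P"] extensionalityI[of _ "buses P"] simp: X_nc_def)
  then have "(S, l, v, s) = forget_phases P (S, I, V, s)"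
    by (simp add: forget_phases_def)
  with mem show "(S, l, v, s) \<in> forget_phases P ` X_bfm P"
    by blast
qed

lemma bij_betw_forget_phases: "bij_betw (forget_phases P) (X_bfm P) (X_angle P)"
  using inj_on_forget_phases forget_phases_in_X_angle X_angle_subset_image
  by (intro bij_betw_imageI subset_antisym) auto

end

theorem theorem7:
  fixes P :: opf and U :: "nat pair_pre_digraph"
  assumes "pair_graph U"
    and "Digraph_Component.connected (with_proj U)"
    and "orientation_of (grid P) U"
    and "pverts (grid P) = buses P"
    and "\<forall>e \<in> lines P. impedance P e \<noteq> 0"
    and "\<forall>j \<in> buses P. 0 < v_min P j \<and> v_min P j \<le> v_max P j"
    and "v_min P 0 = 1" and "v_max P 0 = 1"
    and "s_min P 0 = (- \<infinity>, - \<infinity>)" and "s_max P 0 = (\<infinity>, \<infinity>)"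
  shows "(\<exists>f. bij_betw f (X_bfm P) (X_angle P)) \<and> X_angle P \<subseteq> X_nc P"
proof -
  interpret U: pair_graph U by fact
  have verts: "pverts U = buses P" and arcs: "lines P \<subseteq> parcs U"
    using assms(3,4) by (auto simp: orientation_of_def lines_def)
  \<comment> \<open>Every arc of \<open>U\<close> is a line in one of its two directions. As
    equality is symmetric, constancy along lines yields constancy along arcs of
    \<open>U\<close>.\<close>
  have arc_line: "(j, k) \<in> lines P \<or> (k, j) \<in> lines P" if "(j, k) \<in> parcs U" for j k
    using assms(3) that by (auto simp: orientation_of_def lines_def)
  interpret opf_network P
  proof
    fix j k :: nat
    assume "(j, k) \<in> lines P"
    then have "(j, k) \<in> parcs U"
      using arcs by blast
    then show "j \<in> buses P \<and> k \<in> buses P \<and> j \<noteq> k"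
      using U.wellformed'[of j k] U.pair_no_loops[of "(j, k)"] verts by auto
  next
    fix f :: "nat \<Rightarrow> complex" and j k
    assume "j \<in> buses P" "k \<in> buses P" and "\<And>j k. (j, k) \<in> lines P \<Longrightarrow> f j = f k"
    then show "f j = f k"
      using connected_eqI[OF assms(2), of j k f] arc_line verts by metis
  qed (use assms in auto)
  show ?thesis
    using bij_betw_forget_phases by (auto simp: X_angle_def)
qed

end
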